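(* Let $G$ be a finite simple connected graph with $N_0$ vertices, $E_0$ edges and circuit rank $r=E_0-N_0+1$. For every $n>0$, $$Kf^*(s^n(G))=8\,Kf^*(s^{n-1}(G))+2^n(2r-1)E_0,$$ and consequently $$Kf^*(s^n(G))=8^n\,Kf^*(G)+\frac{8^n-2^n}{3}(2r-1)E_0.$$
   Context: The subdivision graph $s(H)$ of a graph $H$ is obtained from $H$ by inserting one new vertex on every edge of $H$; $s^0(G)=G$ and $s^n(G)=s(s^{n-1}(G))$. For a connected graph $H$, the resistance distance $r_{ij}$ between vertices $i,j$ is the effective resistance between $i$ and $j$ in the electrical network obtained by replacing each edge of $H$ with a unit resistor. The multiplicative degree-Kirchhoff index is $Kf^*(H)=\sum_{i<j}d_id_jr_{ij}$, where $d_i$ is the degree of vertex $i$ and the sum is over unordered pairs of distinct vertices. *)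

theory Defs
  imports Complex_Main "HOL-Library.Uprod" "Graph_Theory.Graph_Theory"
begin

text \<open>
  A finite simple graph is a \<^locale>\<open>pair_graph\<close>: every undirected edge between \<open>u\<close> and \<open>v\<close>
  is represented by the two arcs \<open>(u, v)\<close> and \<open>(v, u)\<close>, and there are no loops.
  Hence \<^const>\<open>out_degree\<close> is the degree, while the number of edges is not
  the number of arcs but the number of unordered pairs below.
\<close>

definition undirected_edges :: "'a pair_pre_digraph \<Rightarrow> 'a uprod set" where
  "undirected_edges H = {Upair u v | u v. (u, v) \<in> parcs H}"

text \<open>
  The type of vertices has to accommodate all iterated subdivisions at once. The vertices of
  the subdivision of \<open>H\<close> are \<open>Old v\<close> for the vertices \<open>v\<close> of \<open>H\<close> and
  \<open>Mid e\<close> for the edges \<open>e\<close> of \<open>H\<close>; as \<open>Old\<close> and \<open>Mid\<close> are distinct constructors,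
  the inserted vertices are new for every \<open>H\<close>. \<open>Base\<close> embeds the original vertices.
\<close>

datatype 'a subdiv_vertex =
    Base 'a
  | Old "'a subdiv_vertex"
  | Mid "'a subdiv_vertex uprod"

definition base_graph :: "'a pair_pre_digraph \<Rightarrow> 'a subdiv_vertex pair_pre_digraph" where
  "base_graph G = \<lparr> pverts = Base ` pverts G, parcs = map_prod Base Base ` parcs G \<rparr>"

definition subdivision_graph ::
    "'a subdiv_vertex pair_pre_digraph \<Rightarrow> 'a subdiv_vertex pair_pre_digraph" where
  "subdivision_graph H =
     \<lparr> pverts = Old ` pverts H \<union> Mid ` undirected_edges H,
       parcs = {(Old u, Mid e) | u e. e \<in> undirected_edges H \<and> u \<in> set_uprod e}
             \<union> {(Mid e, Old u) | u e. e \<in> undirected_edges H \<and> u \<in> set_uprod e} \<rparr>"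

definition iterated_subdivision ::
    "nat \<Rightarrow> 'a pair_pre_digraph \<Rightarrow> 'a subdiv_vertex pair_pre_digraph" where
  "iterated_subdivision n G = (subdivision_graph ^^ n) (base_graph G)"

text \<open>
  \<open>p\<close> is an electric potential for a unit current entering the network at \<open>i\<close> and leaving it
  at \<open>j\<close>. By Ohm's law the current through the unit resistor from \<open>v\<close> to \<open>w\<close> is
  \<open>p v - p w\<close>, so Kirchhoff's current law gives the equations below.
\<close>

definition unit_current_potential ::
    "'a pair_pre_digraph \<Rightarrow> 'a \<Rightarrow> 'a \<Rightarrow> ('a \<Rightarrow> real) \<Rightarrow> bool" where
  "unit_current_potential H i j p \<longleftrightarrow>
     (\<forall>v \<in> pverts H. (\<Sum>w | (v, w) \<in> parcs H. p v - p w) = of_bool (v = i) - of_bool (v = j))"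

text \<open>
  On a connected graph the potential exists and is unique up to an additive constant, so the
  potential difference is determined.
\<close>

definition resistance_distance :: "'a pair_pre_digraph \<Rightarrow> 'a \<Rightarrow> 'a \<Rightarrow> real" where
  "resistance_distance H i j = (THE R. \<exists>p. unit_current_potential H i j p \<and> R = p i - p j)"

lemma unit_current_potential_uminus:
  "unit_current_potential H i j p \<Longrightarrow> unit_current_potential H j i (\<lambda>v. - p v)"
  by (simp add: unit_current_potential_def sum_subtractf sum_negf algebra_simps)

lemma resistance_distance_commute:
  "resistance_distance H i j = resistance_distance H j i"
proof -
  have "\<exists>p. unit_current_potential H b a p \<and> R = p b - p a"
    if "\<exists>p. unit_current_potential H a b p \<and> R = p a - p b" for a b R
  proof -
    from that obtain p where "unit_current_potential H a b p" "R = p a - p b" by blast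
    then show ?thesis
      by (intro exI[of _ "\<lambda>v. - p v"]) (simp add: unit_current_potential_uminus)
  qed
  then have "(\<exists>p. unit_current_potential H i j p \<and> R = p i - p j) \<longleftrightarrow>
      (\<exists>p. unit_current_potential H j i p \<and> R = p j - p i)" for R
    by blast
  then show ?thesis by (simp add: resistance_distance_def)
qed

text \<open>
  The sum over unordered pairs of distinct vertices is half the sum over ordered pairs, the
  summand being symmetric; see the lemma that follows.
\<close>

definition degree_Kirchhoff_index :: "'a pair_pre_digraph \<Rightarrow> real" where
  "degree_Kirchhoff_index H =
     (\<Sum>i \<in> pverts H. \<Sum>j \<in> pverts H - {i}.
        real (out_degree (with_proj H) i) * real (out_degree (with_proj H) j)
          * resistance_distance H i j) / 2"

lemma degree_Kirchhoff_index_less: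
  fixes H :: "'a :: linorder pair_pre_digraph"
  assumes "finite (pverts H)"
  shows "degree_Kirchhoff_index H =
    (\<Sum>i \<in> pverts H. \<Sum>j \<in> {j \<in> pverts H. i < j}.
       real (out_degree (with_proj H) i) * real (out_degree (with_proj H) j)
         * resistance_distance H i j)"
proof -
  define V where "V = pverts H"
  define f where "f i j = real (out_degree (with_proj H) i) * real (out_degree (with_proj H) j)
    * resistance_distance H i j" for i j
  have [simp]: "finite V" using assms by (simp add: V_def)
  have f_commute: "f i j = f j i" for i j
    by (simp add: f_def resistance_distance_commute[of H i j])
  have "(\<Sum>i\<in>V. \<Sum>j\<in>V - {i}. f i j)
      = (\<Sum>i\<in>V. (\<Sum>j | j \<in> V \<and> i < j. f i j) + (\<Sum>j | j \<in> V \<and> j < i. f i j))"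
    by (intro sum.cong refl, subst sum.union_disjoint[symmetric]) (auto intro!: sum.cong)
  also have "\<dots> = (\<Sum>i\<in>V. \<Sum>j | j \<in> V \<and> i < j. f i j) + (\<Sum>i\<in>V. \<Sum>j | j \<in> V \<and> j < i. f i j)"
    by (rule sum.distrib)
  also have "(\<Sum>i\<in>V. \<Sum>j | j \<in> V \<and> j < i. f i j) = (\<Sum>j\<in>V. \<Sum>i | i \<in> V \<and> j < i. f i j)"
    by (rule sum.swap_restrict) simp_all
  also have "\<dots> = (\<Sum>i\<in>V. \<Sum>j | j \<in> V \<and> i < j. f i j)"
    by (intro sum.cong refl f_commute)
  finally show ?thesis
    by (simp add: degree_Kirchhoff_index_def V_def f_def)
qed

end

theory Submission
  imports Defs "Jordan_Normal_Form.Determinant"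
begin

text \<open>
  A kernel \<open>g\<close> whose columns satisfy \<open>L g(-, y) = \<delta>\<^sub>y - k\<close> for the Laplacian \<open>L\<close>, with \<open>k\<close> not depending
  on \<open>y\<close>, determines all resistances by \<open>r\<^sub>x\<^sub>y = g(x, x) - g(x, y) - g(y, x) + g(y, y)\<close>. Hence
  \<open>Kf\<^sup>* = 2 m A - B\<close>, where \<open>m\<close> is the number of edges, \<open>A = \<Sum>\<^sub>x d\<^sub>x g(x, x)\<close> and
  \<open>B = \<Sum>\<^sub>x \<Sum>\<^sub>y d\<^sub>x d\<^sub>y g(x, y)\<close>. Subdivision turns a kernel into an explicit kernel of the subdivided
  graph, for which \<open>m' = 2 m\<close>, \<open>A' = 4 A + r\<close> (using that \<open>\<Sum>\<^sub>x (L g(-, x)) (x) = N - 1\<close>) and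
  \<open>B' = 8 B + 2 m\<close>; so \<open>2 m' A' - B' = 8 (2 m A - B) + 2 m (2 r - 1)\<close>. As \<open>r\<close> is invariant and \<open>m\<close>
  doubles, the theorem follows by iteration.
\<close>

section \<open>Potential kernels\<close>

definition laplacian :: "'a pair_pre_digraph \<Rightarrow> ('a \<Rightarrow> real) \<Rightarrow> 'a \<Rightarrow> real" where
  "laplacian H p v = (\<Sum>w | (v, w) \<in> parcs H. p v - p w)"

text \<open>The column at \<open>y\<close> is the potential of a unit current entering at
  \<open>y\<close> and drained according to \<open>k\<close>. The drain is left arbitrary because a
  uniform one does not survive subdivision: the new kernel drains at old vertices only.\<close>

definition potential_kernel ::
    "'a pair_pre_digraph \<Rightarrow> ('a \<Rightarrow> real) \<Rightarrow> ('a \<Rightarrow> 'a \<Rightarrow> real) \<Rightarrow> bool" where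
  "potential_kernel H k g \<longleftrightarrow>
     (\<forall>x \<in> pverts H. \<forall>y \<in> pverts H. laplacian H (\<lambda>x. g x y) x = of_bool (x = y) - k x)"

lemma unit_current_potential_iff_laplacian:
  "unit_current_potential H i j p \<longleftrightarrow>
     (\<forall>v \<in> pverts H. laplacian H p v = of_bool (v = i) - of_bool (v = j))"
  by (simp add: unit_current_potential_def laplacian_def)

lemma laplacian_diff:
  "laplacian H (\<lambda>x. p x - q x) v = laplacian H p v - laplacian H q v"
  by (simp add: laplacian_def sum_subtractf right_diff_distrib)

lemma undirected_edges_eq_image: "undirected_edges H = (\<lambda>(u, v). Upair u v) ` parcs H"
  by (auto simp: undirected_edges_def)

context pair_graph
begin

lemma finite_neighbours: "finite {w. (v, w) \<in> parcs G}"
  by (rule finite_subset[of _ "snd ` parcs G"]) (force simp: pair_finite_arcs)+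

section \<open>Arc sums and Green's identity\<close>

lemma sum_parcs:
  "(\<Sum>(u, v) \<in> parcs G. f u v) = (\<Sum>u \<in> pverts G. \<Sum>v | (u, v) \<in> parcs G. f u v)"
proof -
  have "parcs G = Sigma (pverts G) (\<lambda>u. {v. (u, v) \<in> parcs G})"
    by (auto dest: in_arcsD1)
  then show ?thesis
    by (simp add: sum.Sigma pair_finite_verts finite_neighbours)
qed

lemma sum_parcs_swap: "(\<Sum>(u, v) \<in> parcs G. f u v) = (\<Sum>(u, v) \<in> parcs G. f v u)"
  by (rule sum.reindex_bij_witness[of _ prod.swap prod.swap])
    (auto dest: arcs_symmetric)

text \<open>Degree weights become arc sums, and arcs are what subdivision transforms simply.\<close>

lemma sum_out_degree:
  fixes f :: "'a \<Rightarrow> real"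
  shows "(\<Sum>u \<in> pverts G. real (out_degree G u) * f u) = (\<Sum>(u, v) \<in> parcs G. f u)"
proof -
  have "out_degree G u = card {v. (u, v) \<in> parcs G}" for u
    unfolding out_degree_def out_arcs_def
    by (rule bij_betw_same_card[of snd]) (force simp: bij_betw_def inj_on_def)
  then show ?thesis
    by (simp add: sum_parcs)
qed

text \<open>Discrete Green identity: averaging \<open>q u * (p u - p v)\<close> with its value on
  the reversed arc gives a form symmetric in \<open>p\<close> and \<open>q\<close>. Each edge counts
  as two arcs, hence the half.\<close>

lemma sum_mult_laplacian:
  "(\<Sum>v \<in> pverts G. q v * laplacian G p v) = (\<Sum>(u, v) \<in> parcs G. (q u - q v) * (p u - p v)) / 2"
proof -
  let ?X = "\<Sum>(u, v) \<in> parcs G. q u * (p u - p v)"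
  have "?X = (\<Sum>(u, v) \<in> parcs G. q v * (p v - p u))"
    by (rule sum_parcs_swap)
  then have "2 * ?X = ?X + (\<Sum>(u, v) \<in> parcs G. q v * (p v - p u))"
    by simp
  also have "\<dots> = (\<Sum>(u, v) \<in> parcs G. (q u - q v) * (p u - p v))"
    unfolding sum.distrib[symmetric] by (rule sum.cong) (auto simp: algebra_simps)
  finally have "?X = (\<Sum>(u, v) \<in> parcs G. (q u - q v) * (p u - p v)) / 2"
    by simp
  moreover have "(\<Sum>v \<in> pverts G. q v * laplacian G p v) = ?X"
    by (simp add: laplacian_def sum_parcs sum_distrib_left)
  ultimately show ?thesis by simp
qed

lemma laplacian_self_adjoint:
  "(\<Sum>v \<in> pverts G. q v * laplacian G p v) = (\<Sum>v \<in> pverts G. laplacian G q v * p v)"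
proof -
  have "(\<Sum>v \<in> pverts G. laplacian G q v * p v) = (\<Sum>v \<in> pverts G. p v * laplacian G q v)"
    by (simp add: mult.commute)
  then show ?thesis
    by (simp add: sum_mult_laplacian mult.commute)
qed

lemma sum_laplacian: "(\<Sum>v \<in> pverts G. laplacian G p v) = 0"
  using sum_mult_laplacian[of "\<lambda>_. 1" p] by simp

section \<open>Resistances and the index in terms of a kernel\<close>

lemma resistance_distance_potential_kernel:
  assumes g: "potential_kernel G k g" and i: "i \<in> pverts G" and j: "j \<in> pverts G"
  shows "resistance_distance G i j = g i i - g i j - g j i + g j j"
  unfolding resistance_distance_def
proof (rule the_equality)
  have "unit_current_potential G i j (\<lambda>x. g x i - g x j)"
    using assms by (simp add: unit_current_potential_iff_laplacian laplacian_diff potential_kernel_def)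
  then show "\<exists>p. unit_current_potential G i j p \<and> g i i - g i j - g j i + g j j = p i - p j"
    by (intro exI[of _ "\<lambda>x. g x i - g x j"]) simp
next
  fix R assume "\<exists>p. unit_current_potential G i j p \<and> R = p i - p j"
  then obtain p where p: "unit_current_potential G i j p" and R: "R = p i - p j" by blast
  \<comment> \<open>Uniqueness: pairing any potential \<open>p\<close> with the column at
    \<open>y\<close> recovers \<open>p y\<close> up to a constant independent of \<open>y\<close>,
    which cancels in \<open>p i - p j\<close>.\<close>
  have "p y - (\<Sum>x \<in> pverts G. k x * p x) = g i y - g j y" if y: "y \<in> pverts G" for y
  proof -
    have "p y - (\<Sum>x \<in> pverts G. k x * p x) = (\<Sum>x \<in> pverts G. (of_bool (x = y) - k x) * p x)"
      using y by (simp add: left_diff_distrib sum_subtractf pair_finite_verts)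
    also have "\<dots> = (\<Sum>x \<in> pverts G. laplacian G (\<lambda>x. g x y) x * p x)"
      using g y by (simp add: potential_kernel_def)
    also have "\<dots> = (\<Sum>x \<in> pverts G. g x y * laplacian G p x)"
      by (rule laplacian_self_adjoint[symmetric])
    also have "\<dots> = (\<Sum>x \<in> pverts G. g x y * (of_bool (x = i) - of_bool (x = j)))"
      using p by (simp add: unit_current_potential_iff_laplacian)
    also have "\<dots> = g i y - g j y"
      using i j by (simp add: right_diff_distrib sum_subtractf pair_finite_verts)
    finally show ?thesis .
  qed
  from this[OF i] this[OF j] show "R = g i i - g i j - g j i + g j j"
    by (simp add: R)
qed

text \<open>The number of arcs is \<open>2 m\<close>; the two arc sums are \<open>A\<close> and
  \<open>B\<close> with their degree weights absorbed.\<close>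

lemma degree_Kirchhoff_index_potential_kernel:
  assumes g: "potential_kernel G k g"
  shows "degree_Kirchhoff_index G = real (card (parcs G)) * (\<Sum>(u, v) \<in> parcs G. g u u)
    - (\<Sum>(u, v) \<in> parcs G. \<Sum>(x, y) \<in> parcs G. g u x)"
proof -
  let ?R = "resistance_distance G" and ?d = "\<lambda>i. real (out_degree G i)"
  let ?r = "\<lambda>i j. g i i - g i j - g j i + g j j"
  let ?A = "\<Sum>(u, v) \<in> parcs G. g u u"
  \<comment> \<open>The kernel expression \<open>?r i i\<close> vanishes, so the diagonal can be
    included.\<close>
  have "(\<Sum>j \<in> pverts G - {i}. ?d i * ?d j * ?R i j) = (\<Sum>j \<in> pverts G. ?d i * ?d j * ?r i j)"
    if "i \<in> pverts G" for i
    using that by (intro sum.mono_neutral_cong_left)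
      (auto simp: resistance_distance_potential_kernel[OF g] pair_finite_verts)
  then have "2 * degree_Kirchhoff_index G
      = (\<Sum>i \<in> pverts G. \<Sum>j \<in> pverts G. ?d i * ?d j * ?r i j)"
    by (simp add: degree_Kirchhoff_index_def)
  also have "\<dots> = (\<Sum>i \<in> pverts G. ?d i * (\<Sum>j \<in> pverts G. ?d j * ?r i j))"
    by (simp add: sum_distrib_left mult.assoc)
  also have "\<dots> = (\<Sum>(u, v) \<in> parcs G. \<Sum>(x, y) \<in> parcs G. ?r u x)"
    by (simp add: sum_out_degree)
  also have "\<dots> = (\<Sum>(u, v) \<in> parcs G. \<Sum>(x, y) \<in> parcs G. g u u)
      - (\<Sum>(u, v) \<in> parcs G. \<Sum>(x, y) \<in> parcs G. g u x)
      - (\<Sum>(u, v) \<in> parcs G. \<Sum>(x, y) \<in> parcs G. g x u)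
      + (\<Sum>(u, v) \<in> parcs G. \<Sum>(x, y) \<in> parcs G. g x x)"
    by (simp add: sum.distrib sum_subtractf split_def)
  also have "(\<Sum>(u, v) \<in> parcs G. \<Sum>(x, y) \<in> parcs G. g x u)
      = (\<Sum>(u, v) \<in> parcs G. \<Sum>(x, y) \<in> parcs G. g u x)"
    unfolding split_def by (rule sum.swap)
  also have "(\<Sum>(u, v) \<in> parcs G. \<Sum>(x, y) \<in> parcs G. g u u) = card (parcs G) * ?A"
    by (simp add: split_def sum_distrib_left)
  also have "(\<Sum>(u, v) \<in> parcs G. \<Sum>(x, y) \<in> parcs G. g x x) = card (parcs G) * ?A"
    by (simp add: split_def)
  finally show ?thesis by simp
qed

text \<open>
  In terms of resistances this is Foster's theorem.
\<close>

lemma sum_parcs_potential_kernel: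
  assumes g: "potential_kernel G k g" and "pverts G \<noteq> {}"
  shows "(\<Sum>(u, v) \<in> parcs G. g u v) = (\<Sum>(u, v) \<in> parcs G. g u u) - real (card (pverts G)) + 1"
    and "(\<Sum>(u, v) \<in> parcs G. g v u) = (\<Sum>(u, v) \<in> parcs G. g u u) - real (card (pverts G)) + 1"
proof -
  obtain y where y: "y \<in> pverts G" using assms by blast
  \<comment> \<open>Summing one column's equations over all vertices shows that the total drain is
    1.\<close>
  have "0 = (\<Sum>x \<in> pverts G. laplacian G (\<lambda>x. g x y) x)"
    by (simp add: sum_laplacian)
  also have "\<dots> = 1 - (\<Sum>x \<in> pverts G. k x)"
    using g y by (simp add: potential_kernel_def sum_subtractf pair_finite_verts)
  finally have k: "(\<Sum>x \<in> pverts G. k x) = 1" by simp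
  \<comment> \<open>This is the trace of \<open>L g\<close>: its diagonal entries are
    \<open>1 - k u\<close>.\<close>
  have "(\<Sum>(u, v) \<in> parcs G. g u u - g v u) = (\<Sum>u \<in> pverts G. laplacian G (\<lambda>x. g x u) u)"
    by (simp add: sum_parcs laplacian_def)
  also have "\<dots> = real (card (pverts G)) - 1"
    using g by (simp add: potential_kernel_def sum_subtractf k)
  finally show "(\<Sum>(u, v) \<in> parcs G. g v u) = (\<Sum>(u, v) \<in> parcs G. g u u) - real (card (pverts G)) + 1"
    by (simp add: split_def sum_subtractf)
  then show "(\<Sum>(u, v) \<in> parcs G. g u v) = (\<Sum>(u, v) \<in> parcs G. g u u) - real (card (pverts G)) + 1"
    by (subst sum_parcs_swap)
qed

lemma card_parcs: "card (parcs G) = 2 * card (undirected_edges G)"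
proof -
  have "card (parcs G) = (\<Sum>e \<in> undirected_edges G. card {a \<in> parcs G. (\<lambda>(u, v). Upair u v) a = e})"
    unfolding card_eq_sum
    by (rule sum.group[symmetric]) (auto simp: pair_finite_arcs undirected_edges_eq_image)
  also have "\<dots> = (\<Sum>e \<in> undirected_edges G. 2)"
  proof (rule sum.cong[OF refl])
    fix e assume "e \<in> undirected_edges G"
    then obtain u v where e: "e = Upair u v" and uv: "(u, v) \<in> parcs G"
      by (auto simp: undirected_edges_def)
    have "{a \<in> parcs G. (\<lambda>(u, v). Upair u v) a = e} = {(u, v), (v, u)}"
      using uv arcs_symmetric[OF uv] by (auto simp: e)
    then show "card {a \<in> parcs G. (\<lambda>(u, v). Upair u v) a = e} = 2"
      using no_loops'[OF uv] by simp
  qed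
  finally show ?thesis by simp
qed

end

section \<open>Existence on connected graphs\<close>

text \<open>An injective square system is solvable. Enumerating \<open>V\<close> reduces this to
  matrices indexed by numbers, where a trivial null space gives a nonzero determinant.\<close>

lemma linear_system_solvable:
  fixes M :: "'a \<Rightarrow> 'a \<Rightarrow> 'b :: field"
  assumes "finite V"
    and ker: "\<And>p. (\<And>v. v \<in> V \<Longrightarrow> (\<Sum>w \<in> V. M v w * p w) = 0) \<Longrightarrow> (\<And>v. v \<in> V \<Longrightarrow> p v = 0)"
  obtains p where "\<And>v. v \<in> V \<Longrightarrow> (\<Sum>w \<in> V. M v w * p w) = b v"
proof -
  define n where "n = card V"
  obtain f where f: "bij_betw f {0..<n} V"
    using ex_bij_betw_nat_finite[OF \<open>finite V\<close>] by (auto simp: n_def)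
  define h where "h = inv_into {0..<n} f"
  have h: "h (f i) = i" if "i < n" for i
    using f that by (simp add: h_def bij_betw_def)
  have V: "\<exists>i < n. v = f i" if "v \<in> V" for v
    using f that by (auto simp: bij_betw_def)
  define A where "A = mat n n (\<lambda>(i, j). M (f i) (f j))"
  have A: "A \<in> carrier_mat n n" by (simp add: A_def)
  have mult: "(A *\<^sub>v x) $ i = (\<Sum>w \<in> V. M (f i) w * x $ h w)" if "x \<in> carrier_vec n" "i < n" for x i
  proof -
    have "(A *\<^sub>v x) $ i = (\<Sum>j \<in> {0..<n}. M (f i) (f j) * x $ h (f j))"
      using that by (simp add: A_def scalar_prod_def h)
    also have "\<dots> = (\<Sum>w \<in> V. M (f i) w * x $ h w)"
      by (rule sum.reindex_bij_betw[OF f])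
    finally show ?thesis .
  qed
  have "det A \<noteq> 0"
  proof
    assume "det A = 0"
    then obtain x where x: "x \<in> carrier_vec n" "x \<noteq> 0\<^sub>v n" and Ax: "A *\<^sub>v x = 0\<^sub>v n"
      using det_0_iff_vec_prod_zero_field[OF A] by blast
    have "(\<Sum>w \<in> V. M v w * x $ h w) = 0" if "v \<in> V" for v
      using V[OF that] mult[OF x(1)] by (auto simp: Ax)
    then have "x $ h v = 0" if "v \<in> V" for v
      using ker[of "\<lambda>w. x $ h w"] that by blast
    then have "x $ i = 0" if "i < n" for i
      using h[OF that] f that by (metis atLeastLessThan_iff bij_betw_apply zero_le)
    then have "x = 0\<^sub>v n"
      using x(1) by (intro eq_vecI) auto
    with x(2) show False by contradiction
  qed
  \<comment> \<open>The argument \<open>()\<close> only fills the extension slot of the matrix ring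
    record. The right inverse \<open>B\<close> gives the solution \<open>B c\<close>.\<close>
  from det_non_zero_imp_unit[OF A this, of "()"] obtain B
    where B: "B \<in> carrier_mat n n" and AB: "A * B = 1\<^sub>m n"
    by (auto simp: Units_def ring_mat_simps)
  define c where "c = vec n (\<lambda>i. b (f i))"
  have c: "c \<in> carrier_vec n" by (simp add: c_def)
  have "A *\<^sub>v (B *\<^sub>v c) = c"
    using A B c by (simp add: assoc_mult_mat_vec[symmetric] AB)
  then have "(\<Sum>w \<in> V. M v w * (B *\<^sub>v c) $ h w) = b v" if "v \<in> V" for v
    using V[OF that] mult[of "B *\<^sub>v c"] B c by (auto simp: c_def)
  then show thesis by (rule that)
qed

text \<open>The energy of \<open>p\<close> is zero, so \<open>p\<close> agrees at the ends of every
  arc and then along every path.\<close>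

lemma (in pair_graph) laplacian_eq_0_imp_constant:
  assumes conn: "Digraph_Component.connected G"
    and p: "\<And>v. v \<in> pverts G \<Longrightarrow> laplacian G p v = 0"
    and "u \<in> pverts G" "v \<in> pverts G"
  shows "p u = p v"
proof -
  have "(\<Sum>(u, v) \<in> parcs G. (p u - p v) * (p u - p v)) = 0"
    using sum_mult_laplacian[of p p] p by simp
  then have arc: "p u = p v" if "(u, v) \<in> parcs G" for u v
    using that by (subst (asm) sum_nonneg_eq_0_iff) (auto simp: pair_finite_arcs)
  have "strongly_connected G"
    using conn by (rule symmetric_connected_imp_strongly_connected[OF pair_sym_arcs])
  then have "u \<rightarrow>\<^sup>*\<^bsub>G\<^esub> v"
    using assms by auto
  then show ?thesis
    by (induction rule: reachable_induct) (auto dest: arc)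
qed

text \<open>
  Adding the all-ones matrix to the Laplacian makes it invertible. As the Laplacian has zero column
  sums, the sum of a solution is determined by the right-hand side, and the extra term only
  contributes a constant.
\<close>

lemma (in pair_graph) potential_kernel_exists:
  assumes conn: "Digraph_Component.connected G"
  obtains k g where "potential_kernel G k g"
proof -
  let ?V = "pverts G"
  define N where "N = real (card ?V)"
  have "?V \<noteq> {}"
    using conn by (auto simp: connected_def strongly_connected_def)
  then have N: "N > 0"
    by (simp add: N_def card_gt_0_iff pair_finite_verts)
  define M where "M v w = of_bool (w = v) * real (card {w. (v, w) \<in> parcs G})
    - of_bool ((v, w) \<in> parcs G) + 1" for v w
  have M: "(\<Sum>w \<in> ?V. M v w * p w) = laplacian G p v + (\<Sum>w \<in> ?V. p w)" if "v \<in> ?V" for p v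
  proof -
    have "(\<Sum>w \<in> ?V. of_bool ((v, w) \<in> parcs G) * p w) = (\<Sum>w | (v, w) \<in> parcs G. p w)"
      by (rule sum.mono_neutral_cong_right) (auto simp: pair_finite_verts dest: in_arcsD2)
    moreover have "(\<Sum>w \<in> ?V. of_bool (w = v) * real (card {w. (v, w) \<in> parcs G}) * p w)
        = real (card {w. (v, w) \<in> parcs G}) * p v"
      using that by (simp add: pair_finite_verts mult.assoc)
    ultimately show ?thesis
      by (simp add: M_def laplacian_def distrib_right left_diff_distrib sum.distrib sum_subtractf)
  qed
  have sum_p: "(\<Sum>w \<in> ?V. p w) = (\<Sum>v \<in> ?V. b v) / N"
    if "\<And>v. v \<in> ?V \<Longrightarrow> (\<Sum>w \<in> ?V. M v w * p w) = b v" for p b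
  proof -
    have "(\<Sum>v \<in> ?V. b v) = (\<Sum>v \<in> ?V. laplacian G p v + (\<Sum>w \<in> ?V. p w))"
      using that M by (intro sum.cong) auto
    also have "\<dots> = N * (\<Sum>w \<in> ?V. p w)"
      by (simp add: sum.distrib sum_laplacian N_def)
    finally show ?thesis using N by simp
  qed
  have ker: "p v = 0" if p: "\<And>v. v \<in> ?V \<Longrightarrow> (\<Sum>w \<in> ?V. M v w * p w) = 0" and v: "v \<in> ?V" for p v
  proof -
    \<comment> \<open>A null vector has sum zero, so it is harmonic, hence constant, hence
      zero.\<close>
    have sum0: "(\<Sum>w \<in> ?V. p w) = 0"
      using sum_p[of p "\<lambda>_. 0"] p by simp
    then have "laplacian G p w = 0" if "w \<in> ?V" for w
      using M[OF that, of p] p[OF that] by simp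
    then have "p w = p v" if "w \<in> ?V" for w
      using laplacian_eq_0_imp_constant[OF conn, of p] v that by blast
    then have "(\<Sum>w \<in> ?V. p w) = N * p v"
      by (simp add: N_def)
    then show ?thesis using sum0 N by simp
  qed
  have "\<exists>p. \<forall>x \<in> ?V. laplacian G p x = of_bool (x = y) - 1 / N" if y: "y \<in> ?V" for y
  proof -
    obtain p where p: "\<And>v. v \<in> ?V \<Longrightarrow> (\<Sum>w \<in> ?V. M v w * p w) = of_bool (v = y)"
      using linear_system_solvable[OF pair_finite_verts, of M "\<lambda>v. of_bool (v = y)"] ker by blast
    \<comment> \<open>The all-ones term thus acts as a uniform drain, the same for every
      \<open>y\<close>.\<close>
    have "(\<Sum>w \<in> ?V. p w) = 1 / N"
      using sum_p[OF p] y by (simp add: pair_finite_verts)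
    then show ?thesis
      using p M[of _ p] by (intro exI[of _ p]) force
  qed
  then obtain q where "\<And>y. y \<in> ?V \<Longrightarrow> \<forall>x \<in> ?V. laplacian G (q y) x = of_bool (x = y) - 1 / N"
    by metis
  then have "potential_kernel G (\<lambda>_. 1 / N) (\<lambda>x y. q y x)"
    by (simp add: potential_kernel_def)
  then show thesis by (rule that)
qed

section \<open>The base graph\<close>

lemma pair_graph_base_graph:
  assumes "pair_graph G"
  shows "pair_graph (base_graph G)"
proof -
  interpret pair_graph G by fact
  show ?thesis
    by unfold_locales
      (auto simp: base_graph_def pair_finite_verts pair_finite_arcs symmetric_def sym_def map_prod_def
        intro: in_arcsD1 in_arcsD2 no_loops' dest: arcs_symmetric no_loops')
qed

text \<open>Transport along the relabelling; values of \<open>the_inv Base\<close> outside the range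
  of \<open>Base\<close> never occur at a vertex.\<close>

lemma potential_kernel_base_graph:
  assumes "pair_graph G" and g: "potential_kernel G k g"
  shows "potential_kernel (base_graph G) (\<lambda>x. k (the_inv Base x)) (\<lambda>x y. g (the_inv Base x) (the_inv Base y))"
proof -
  have inv: "the_inv Base (Base x) = x" for x :: 'a
    by (rule the_inv_f_f) (simp add: inj_def)
  have "{w. (Base v, w) \<in> parcs (base_graph G)} = Base ` {w. (v, w) \<in> parcs G}" for v
    by (auto simp: base_graph_def)
  then have lap: "laplacian (base_graph G) (\<lambda>x. p (the_inv Base x)) (Base v) = laplacian G p v" for p v
    by (simp add: laplacian_def sum.reindex inj_on_def inv)
  have "pverts (base_graph G) = Base ` pverts G"
    by (simp add: base_graph_def)
  then show ?thesis
    using g by (auto simp: potential_kernel_def inv lap[of "\<lambda>x. g x y" for y])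
qed

text \<open>Comparing the kernel formulas on both sides avoids transporting resistances
  themselves.\<close>

lemma degree_Kirchhoff_index_base_graph:
  assumes "pair_graph G" and g: "potential_kernel G k g"
  shows "degree_Kirchhoff_index (base_graph G) = degree_Kirchhoff_index G"
proof -
  interpret pair_graph G by fact
  interpret B: pair_graph "base_graph G" by (rule pair_graph_base_graph) fact
  have inv: "the_inv Base (Base x) = x" for x :: 'a
    by (rule the_inv_f_f) (simp add: inj_def)
  have inj: "inj_on (map_prod Base Base) A" for A :: "('a \<times> 'a) set"
    by (auto simp: inj_on_def)
  show ?thesis
    unfolding degree_Kirchhoff_index_potential_kernel[OF g]
      B.degree_Kirchhoff_index_potential_kernel[OF potential_kernel_base_graph[OF assms]]
    by (simp add: base_graph_def card_image inj sum.reindex split_def inv)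
qed

lemma card_base_graph:
  "card (pverts (base_graph G)) = card (pverts G)"
  "card (parcs (base_graph G)) = card (parcs G)"
  by (auto simp: base_graph_def inj_on_def intro!: card_image)

section \<open>Subdivision\<close>

text \<open>By symmetry of the arcs, incidences of a vertex \<open>u\<close> with an edge correspond
  to arcs leaving \<open>u\<close>; each yields a half-edge in both directions.\<close>

lemma parcs_subdivision_graph:
  assumes "pair_graph H"
  shows "parcs (subdivision_graph H) = (\<lambda>(u, v). (Old u, Mid (Upair u v))) ` parcs H
    \<union> (\<lambda>(u, v). (Mid (Upair u v), Old u)) ` parcs H"
proof -
  interpret pair_graph H by fact
  have *: "e \<in> undirected_edges H \<and> u \<in> set_uprod e \<longleftrightarrow> (\<exists>v. (u, v) \<in> parcs H \<and> e = Upair u v)"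
    for u e
    by (auto simp: undirected_edges_def) (blast dest: arcs_symmetric)+
  show ?thesis
    unfolding subdivision_graph_def * by force
qed

lemma pair_graph_subdivision_graph:
  assumes "pair_graph H"
  shows "pair_graph (subdivision_graph H)"
proof -
  interpret pair_graph H by fact
  have "finite (parcs (subdivision_graph H))" "finite (pverts (subdivision_graph H))"
    unfolding parcs_subdivision_graph[OF assms]
    by (auto simp: subdivision_graph_def undirected_edges_eq_image pair_finite_verts pair_finite_arcs)
  moreover have "Old u \<in> pverts (subdivision_graph H) \<longleftrightarrow> u \<in> pverts H"
    and "Mid e \<in> pverts (subdivision_graph H) \<longleftrightarrow> e \<in> undirected_edges H" for u e
    by (auto simp: subdivision_graph_def)
  moreover have "(x, y) \<in> parcs (subdivision_graph H) \<longleftrightarrow>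
      (\<exists>u e. e \<in> undirected_edges H \<and> u \<in> set_uprod e \<and>
        (x = Old u \<and> y = Mid e \<or> x = Mid e \<and> y = Old u))" for x y
    by (auto simp: subdivision_graph_def)
  moreover have "u \<in> pverts H" if "e \<in> undirected_edges H" "u \<in> set_uprod e" for u e
    using that by (auto simp: undirected_edges_def dest: in_arcsD1 in_arcsD2)
  ultimately show ?thesis
    by unfold_locales (auto simp: symmetric_def intro!: symI)
qed

lemma sum_parcs_subdivision_graph:
  assumes "pair_graph H"
  shows "(\<Sum>(x, y) \<in> parcs (subdivision_graph H). f x y)
    = (\<Sum>(u, v) \<in> parcs H. f (Old u) (Mid (Upair u v)) + f (Mid (Upair u v)) (Old u))"
proof -
  interpret pair_graph H by fact
  let ?out = "\<lambda>(u, v). (Old u, Mid (Upair u v))" and ?in = "\<lambda>(u, v). (Mid (Upair u v), Old u)"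
  have inj: "inj_on ?out (parcs H)" "inj_on ?in (parcs H)"
    by (auto simp: inj_on_def)
  have "(\<Sum>(x, y) \<in> parcs (subdivision_graph H). f x y)
      = (\<Sum>(x, y) \<in> ?out ` parcs H. f x y) + (\<Sum>(x, y) \<in> ?in ` parcs H. f x y)"
    unfolding parcs_subdivision_graph[OF assms]
    by (rule sum.union_disjoint) (auto simp: pair_finite_arcs)
  then show ?thesis
    unfolding sum.reindex[OF inj(1)] sum.reindex[OF inj(2)]
    by (simp add: sum.distrib split_def)
qed

text \<open>These counts keep the circuit rank:
  \<open>2 m - (N + m) + 1 = m - N + 1\<close>.\<close>

lemma card_subdivision_graph:
  assumes "pair_graph H"
  shows "card (pverts (subdivision_graph H)) = card (pverts H) + card (undirected_edges H)"
    and "card (undirected_edges (subdivision_graph H)) = 2 * card (undirected_edges H)"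
proof -
  interpret pair_graph H by fact
  interpret S: pair_graph "subdivision_graph H" by (rule pair_graph_subdivision_graph) fact
  show "card (pverts (subdivision_graph H)) = card (pverts H) + card (undirected_edges H)"
    unfolding subdivision_graph_def pair_pre_digraph.simps
    by (subst card_Un_disjoint)
      (auto simp: pair_finite_verts pair_finite_arcs undirected_edges_eq_image card_image inj_on_def)
  have "card (parcs (subdivision_graph H)) = 2 * card (parcs H)"
    using sum_parcs_subdivision_graph[OF assms, of "\<lambda>_ _. 1 :: nat"] by (simp add: split_def)
  then show "card (undirected_edges (subdivision_graph H)) = 2 * card (undirected_edges H)"
    by (simp add: card_parcs S.card_parcs)
qed

section \<open>Laplacian and kernel of the subdivided graph\<close>

lemma laplacian_subdivision_graph_Old:
  assumes "pair_graph H"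
  shows "laplacian (subdivision_graph H) p (Old u)
    = (\<Sum>v | (u, v) \<in> parcs H. p (Old u) - p (Mid (Upair u v)))"
proof -
  have "{w. (Old u, w) \<in> parcs (subdivision_graph H)}
      = (\<lambda>v. Mid (Upair u v)) ` {v. (u, v) \<in> parcs H}"
    by (force simp: parcs_subdivision_graph[OF assms])
  then show ?thesis
    by (simp add: laplacian_def sum.reindex inj_on_def)
qed

lemma laplacian_subdivision_graph_Mid:
  assumes "pair_graph H" and uv: "(u, v) \<in> parcs H"
  shows "laplacian (subdivision_graph H) p (Mid (Upair u v))
    = 2 * p (Mid (Upair u v)) - p (Old u) - p (Old v)"
proof -
  interpret pair_graph H by fact
  have "{w. (Mid (Upair u v), w) \<in> parcs (subdivision_graph H)} = {Old u, Old v}"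
    using uv arcs_symmetric[OF uv] by (force simp: parcs_subdivision_graph[OF assms(1)])
  then show ?thesis
    using no_loops'[OF uv] by (simp add: laplacian_def)
qed

text \<open>
  A unit current entering the network at the midpoint of an edge acts on the old vertices like half
  a unit at either end. The extension below encodes this, doubled to avoid fractions.
\<close>

definition subdivision_extension ::
    "('a subdiv_vertex \<Rightarrow> real) \<Rightarrow> 'a subdiv_vertex \<Rightarrow> real" where
  "subdivision_extension f x =
     (case x of Base _ \<Rightarrow> 0 | Old v \<Rightarrow> 2 * f v | Mid e \<Rightarrow> \<Sum>v \<in> set_uprod e. f v)"

lemma subdivision_extension_simps:
  "subdivision_extension f (Old v) = 2 * f v"
  "u \<noteq> v \<Longrightarrow> subdivision_extension f (Mid (Upair u v)) = f u + f v"
  by (simp_all add: subdivision_extension_def)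

text \<open>Extending in both variables gives \<open>4 g\<close> on old vertices; halving leaves
  \<open>2 g\<close>, as two resistors in series require. The correction is 1/2 on the diagonal at
  midpoints: the potential that a unit current creates there when both ends are grounded.\<close>

definition subdivision_kernel ::
    "('a subdiv_vertex \<Rightarrow> 'a subdiv_vertex \<Rightarrow> real) \<Rightarrow> 'a subdiv_vertex \<Rightarrow> 'a subdiv_vertex \<Rightarrow> real"
  where
  "subdivision_kernel g x y =
     (subdivision_extension (\<lambda>a. subdivision_extension (g a) y) x
        + of_bool (x = y \<and> x \<in> range Mid)) / 2"

lemma potential_kernel_subdivision_graph:
  assumes "pair_graph H" and g: "potential_kernel H k g"
  shows "potential_kernel (subdivision_graph H)
    (\<lambda>x. case x of Old v \<Rightarrow> k v | _ \<Rightarrow> 0) (subdivision_kernel g)"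
proof -
  interpret pair_graph H by fact
  let ?S = "subdivision_graph H" and ?h = "subdivision_kernel g"
  let ?F = "\<lambda>y a. subdivision_extension (g a) y"
  \<comment> \<open>A half-edge carries the potential drop of the original edge, so the currents at
    old vertices are those of \<open>H\<close>.\<close>
  have Old_Old: "laplacian ?S (\<lambda>x. ?h x (Old v)) (Old w) = of_bool (w = v) - k w"
    if "w \<in> pverts H" "v \<in> pverts H" for v w
  proof -
    have "laplacian ?S (\<lambda>x. ?h x (Old v)) (Old w) = laplacian H (\<lambda>a. g a v) w"
      unfolding laplacian_subdivision_graph_Old[OF assms(1)] unfolding laplacian_def
      by (rule sum.cong) (auto simp: subdivision_kernel_def subdivision_extension_simps no_loops' field_simps)
    then show ?thesis using g that by (simp add: potential_kernel_def)
  qed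
  \<comment> \<open>The columns at \<open>c\<close> and \<open>d\<close> each contribute half a unit
    source at their own vertex; the correction at the midpoint cancels both and leaves only the
    drain.\<close>
  have Old_Mid: "laplacian ?S (\<lambda>x. ?h x (Mid (Upair c d))) (Old w) = - k w"
    if w: "w \<in> pverts H" and cd: "(c, d) \<in> parcs H" for c d w
  proof -
    note c = in_arcsD1[OF cd] and d = in_arcsD2[OF cd] and dc = arcs_symmetric[OF cd]
      and ne = no_loops'[OF cd]
    let ?N = "{b. (w, b) \<in> parcs H}"
    have "of_bool (Upair w b = Upair c d) = of_bool (w = c) * of_bool (b = d) + (of_bool (w = d) * of_bool (b = c) :: real)" for b
      using ne by auto
    then have "(\<Sum>b \<in> ?N. of_bool (Upair w b = Upair c d)) = (of_bool (w = c) + of_bool (w = d) :: real)"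
      using cd dc ne by (simp add: sum.distrib finite_neighbours)
    moreover have "laplacian ?S (\<lambda>x. ?h x (Mid (Upair c d))) (Old w)
       = (\<Sum>b \<in> ?N. ((g w c - g b c) + (g w d - g b d) - of_bool (Upair w b = Upair c d)) / 2)"
      unfolding laplacian_subdivision_graph_Old[OF assms(1)]
      by (rule sum.cong)
        (use ne in \<open>auto simp: subdivision_kernel_def subdivision_extension_simps no_loops' field_simps\<close>)
    then have "laplacian ?S (\<lambda>x. ?h x (Mid (Upair c d))) (Old w)
       = (laplacian H (\<lambda>a. g a c) w + laplacian H (\<lambda>a. g a d) w
          - (\<Sum>b \<in> ?N. of_bool (Upair w b = Upair c d))) / 2"
      by (simp only: laplacian_def sum_subtractf sum.distrib sum_divide_distrib[symmetric])
    ultimately show ?thesis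
      using g w c d by (simp add: potential_kernel_def)
  qed
  \<comment> \<open>The extension at a midpoint is the mean of its values at the ends, so only the
    correction contributes.\<close>
  have Mid: "laplacian ?S (\<lambda>x. ?h x y) (Mid (Upair a b)) = of_bool (Mid (Upair a b) = y)"
    if "(a, b) \<in> parcs H" for a b y
    using no_loops'[OF that]
    by (auto simp: laplacian_subdivision_graph_Mid[OF assms(1) that] subdivision_kernel_def
      subdivision_extension_simps field_simps)
  have pverts: "pverts ?S = Old ` pverts H \<union> (\<lambda>(u, v). Mid (Upair u v)) ` parcs H"
    by (auto simp: subdivision_graph_def undirected_edges_eq_image)
  show ?thesis
    unfolding potential_kernel_def pverts by (auto simp: Old_Old Old_Mid Mid)
qed

section \<open>The index of the subdivided graph\<close>

lemma degree_Kirchhoff_index_subdivision_graph: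
  fixes H :: "'a subdiv_vertex pair_pre_digraph"
  assumes "pair_graph H" and g: "potential_kernel H k g" and ne: "pverts H \<noteq> {}"
  defines "m \<equiv> real (card (undirected_edges H))"
  shows "degree_Kirchhoff_index (subdivision_graph H) = 8 * degree_Kirchhoff_index H
    + 2 * m * (2 * (m - real (card (pverts H)) + 1) - 1)"
proof -
  interpret pair_graph H by fact
  interpret S: pair_graph "subdivision_graph H" by (rule pair_graph_subdivision_graph) fact
  let ?P = "parcs H" and ?h = "subdivision_kernel g" and ?N = "real (card (pverts H))"
  define A where "A = (\<Sum>(u, v) \<in> ?P. g u u)"
  define B where "B = (\<Sum>(u, v) \<in> ?P. \<Sum>(x, y) \<in> ?P. g u x)"
  have cP: "real (card ?P) = 2 * m" by (simp add: card_parcs m_def)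
  have "(\<Sum>(x, y) \<in> parcs (subdivision_graph H). ?h x x)
      = (\<Sum>(u, v) \<in> ?P. 2 * g u u + (g u u + g u v + g v u + g v v + 1) / 2)"
    unfolding sum_parcs_subdivision_graph[OF assms(1)]
    by (rule sum.cong) (auto simp: subdivision_kernel_def subdivision_extension_simps no_loops')
  also have "\<dots> = 2 * A + (A + (\<Sum>(u, v) \<in> ?P. g u v) + (\<Sum>(u, v) \<in> ?P. g v u) + (\<Sum>(u, v) \<in> ?P. g v v) + 2 * m) / 2"
    by (simp add: split_def sum.distrib sum_divide_distrib[symmetric] sum_distrib_left[symmetric] A_def cP)
  also have "(\<Sum>(u, v) \<in> ?P. g v v) = A"
    unfolding A_def by (rule sum_parcs_swap)
  \<comment> \<open>The mixed sums \<open>g u v\<close> and \<open>g v u\<close> are eliminated by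
    Foster's theorem, which is where the circuit rank enters.\<close>
  finally have A': "(\<Sum>(x, y) \<in> parcs (subdivision_graph H). ?h x x) = 4 * A + m - ?N + 1"
    by (simp add: sum_parcs_potential_kernel[OF g ne] A_def)
  \<comment> \<open>An arc shares its edge with itself and its reverse. Over all \<open>2 m\<close>
    arcs this gives \<open>4 m\<close>, halved in \<open>B'\<close>.\<close>
  have pairs: "(\<Sum>(x, y) \<in> ?P. of_bool (Upair u v = Upair x y)) = (2 :: real)" if uv: "(u, v) \<in> ?P" for u v
  proof -
    have "(\<Sum>(x, y) \<in> ?P. of_bool (Upair u v = Upair x y)) = (\<Sum>(x, y) \<in> {(u, v), (v, u)}. 1 :: real)"
      using uv arcs_symmetric[OF uv] by (intro sum.mono_neutral_cong_right) (auto simp: pair_finite_arcs)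
    then show ?thesis using no_loops'[OF uv] by simp
  qed
  \<comment> \<open>The summands are the old-old, old-mid, mid-old and mid-mid values. Reversing
    arcs in either variable turns every kernel sum into \<open>B\<close>, so each block contributes
    \<open>2 B\<close>.\<close>
  have "(\<Sum>(x, y) \<in> parcs (subdivision_graph H). \<Sum>(x', y') \<in> parcs (subdivision_graph H). ?h x x')
      = (\<Sum>(u, v) \<in> ?P. \<Sum>(x, y) \<in> ?P. 2 * g u x + (g u x + g u y) + (g u x + g v x)
          + (g u x + g u y + g v x + g v y + of_bool (Upair u v = Upair x y)) / 2)"
    unfolding sum_parcs_subdivision_graph[OF assms(1)]
    unfolding split_def
    unfolding sum.distrib[symmetric]
    by (intro sum.cong refl)
      (auto simp: subdivision_kernel_def subdivision_extension_simps no_loops' field_simps)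
  also have "\<dots> = 2 * B + (B + (\<Sum>(u, v) \<in> ?P. \<Sum>(x, y) \<in> ?P. g u y)) + (B + (\<Sum>(u, v) \<in> ?P. \<Sum>(x, y) \<in> ?P. g v x))
     + (B + (\<Sum>(u, v) \<in> ?P. \<Sum>(x, y) \<in> ?P. g u y) + (\<Sum>(u, v) \<in> ?P. \<Sum>(x, y) \<in> ?P. g v x)
        + (\<Sum>(u, v) \<in> ?P. \<Sum>(x, y) \<in> ?P. g v y)
        + (\<Sum>(u, v) \<in> ?P. \<Sum>(x, y) \<in> ?P. of_bool (Upair u v = Upair x y))) / 2"
    by (simp add: split_def sum.distrib sum_divide_distrib[symmetric] sum_distrib_left[symmetric] B_def)
  also have "(\<Sum>(u, v) \<in> ?P. \<Sum>(x, y) \<in> ?P. g u y) = B"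
    unfolding B_def by (intro sum.cong refl) (auto intro: sum_parcs_swap)
  also have "(\<Sum>(u, v) \<in> ?P. \<Sum>(x, y) \<in> ?P. g v x) = B"
    unfolding B_def by (rule sum_parcs_swap)
  also have "(\<Sum>(u, v) \<in> ?P. \<Sum>(x, y) \<in> ?P. g v y) = B"
    unfolding B_def by (subst sum_parcs_swap) (intro sum.cong refl, auto intro: sum_parcs_swap)
  also have "(\<Sum>(u, v) \<in> ?P. \<Sum>(x, y) \<in> ?P. of_bool (Upair u v = Upair x y)) = (\<Sum>(u, v) \<in> ?P. 2 :: real)"
    by (rule sum.cong) (simp_all only: split_paired_all prod.case pairs)
  finally have B': "(\<Sum>(x, y) \<in> parcs (subdivision_graph H). \<Sum>(x', y') \<in> parcs (subdivision_graph H). ?h x x')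
      = 8 * B + 2 * m"
    by (simp add: split_def cP)
  have "real (card (parcs (subdivision_graph H))) = 4 * m"
    by (simp add: S.card_parcs card_subdivision_graph(2)[OF assms(1)] m_def)
  then show ?thesis
    unfolding degree_Kirchhoff_index_potential_kernel[OF g]
      S.degree_Kirchhoff_index_potential_kernel[OF potential_kernel_subdivision_graph[OF assms(1) g]]
      A' B' cP A_def[symmetric] B_def[symmetric]
    by (simp add: algebra_simps)
qed

section \<open>Iterating the recurrence\<close>

theorem theorem1:
  fixes G :: "'a pair_pre_digraph" and N0 E0 n :: nat and r :: int
  assumes "pair_graph G"
    and "Digraph_Component.connected (with_proj G)"
    and "N0 = card (pverts G)"
    and "E0 = card (undirected_edges G)"
    and "r = int E0 - int N0 + 1"
    and "n > 0"
  shows "degree_Kirchhoff_index (iterated_subdivision n G)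
           = 8 * degree_Kirchhoff_index (iterated_subdivision (n - 1) G)
             + 2 ^ n * (2 * real_of_int r - 1) * real E0
       \<and> degree_Kirchhoff_index (iterated_subdivision n G)
           = 8 ^ n * degree_Kirchhoff_index G
             + (8 ^ n - 2 ^ n) / 3 * (2 * real_of_int r - 1) * real E0"
proof -
  interpret pair_graph G by fact
  let ?H = "\<lambda>n. iterated_subdivision n G"
  let ?c = "(2 * real_of_int r - 1) * real E0"
  have H0: "?H 0 = base_graph G" and H_Suc: "?H (Suc l) = subdivision_graph (?H l)" for l
    by (simp_all add: iterated_subdivision_def)
  interpret B: pair_graph "base_graph G" by (rule pair_graph_base_graph) fact
  obtain k g where g: "potential_kernel G k g"
    using potential_kernel_exists assms(2) by blast
  have ne: "pverts G \<noteq> {}"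
    using assms(2) by (auto simp: Digraph_Component.connected_def strongly_connected_def)
  \<comment> \<open>Kernels are passed on by the explicit construction, so connectedness enters only
    through \<open>G\<close>.\<close>
  have inv: "pair_graph (?H l) \<and> (\<exists>k g. potential_kernel (?H l) k g) \<and> pverts (?H l) \<noteq> {}
    \<and> card (undirected_edges (?H l)) = 2 ^ l * E0
    \<and> int (card (undirected_edges (?H l))) - int (card (pverts (?H l))) + 1 = r" for l
  proof (induction l)
    case 0
    have "card (undirected_edges (base_graph G)) = card (undirected_edges G)"
      using card_base_graph(2)[of G] by (simp add: card_parcs B.card_parcs)
    then show ?case
      using B.pair_graph potential_kernel_base_graph[OF assms(1) g] ne assms
      by (auto simp: H0 card_base_graph) (simp add: base_graph_def)
  next
    case (Suc l)
    then have "pair_graph (?H l)" by blast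
    with Suc show ?case
      using pair_graph_subdivision_graph[of "?H l"] potential_kernel_subdivision_graph[of "?H l"]
      by (auto simp: H_Suc card_subdivision_graph) (simp add: subdivision_graph_def)
  qed
  \<comment> \<open>Level \<open>l\<close> has \<open>2 ^ l * E0\<close> edges; the factor 2 in the
    single-step formula raises the power to \<open>Suc l\<close>.\<close>
  have step: "degree_Kirchhoff_index (?H (Suc l)) = 8 * degree_Kirchhoff_index (?H l) + 2 ^ Suc l * ?c" for l
  proof -
    obtain k g where "potential_kernel (?H l) k g" using inv[of l] by blast
    from degree_Kirchhoff_index_subdivision_graph[OF _ this] inv[of l]
    have "degree_Kirchhoff_index (?H (Suc l)) = 8 * degree_Kirchhoff_index (?H l)
      + 2 * real (card (undirected_edges (?H l)))
          * (2 * (real (card (undirected_edges (?H l))) - real (card (pverts (?H l))) + 1) - 1)"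
      by (simp add: H_Suc)
    moreover have "real (card (undirected_edges (?H l))) - real (card (pverts (?H l))) + 1 = real_of_int r"
    proof -
      have "int (card (undirected_edges (?H l))) - int (card (pverts (?H l))) + 1 = r"
        using inv[of l] by blast
      from arg_cong[OF this, of real_of_int] show ?thesis by simp
    qed
    ultimately show ?thesis
      using inv[of l] by simp
  qed
  \<comment> \<open>The coefficient solves \<open>a (Suc l) = 8 * a l + 2 ^ Suc l\<close> with
    \<open>a 0 = 0\<close>, a geometric sum of ratio 4; hence the denominator 3.\<close>
  have closed: "degree_Kirchhoff_index (?H l) = 8 ^ l * degree_Kirchhoff_index G + (8 ^ l - 2 ^ l) / 3 * ?c" for l
  proof (induction l)
    case 0
    then show ?case
      by (simp add: H0 degree_Kirchhoff_index_base_graph[OF assms(1) g])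
  next
    case (Suc l)
    show ?case
      unfolding step Suc.IH by (simp add: field_simps)
  qed
  show ?thesis
    using step[of "n - 1"] closed[of n] \<open>n > 0\<close> by (simp add: mult.assoc)
qed

end
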